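(* Let $G$ be a finite directed graph with a global sink, with a fixed cyclic ordering of the outgoing edges at each non-sink vertex, and let $\sigma_1$ and $\sigma_2$ be recurrent chip configurations on $G$. If there is an acyclic rotor configuration $\rho$ of $G$ such that $\sigma_1(\rho)=\sigma_2(\rho)$, then $\sigma_1=\sigma_2$.
   Context: Directed graphs are finite; self-loops and multiple edges are allowed. A sink is a vertex of out-degree zero; a global sink is a sink $s$ such that from every other vertex there is a directed path leading to $s$. Let $d_v$ be the out-degree of $v$ and $a_{vw}$ the number of edges from $v$ to $w$. Chip-firing: a chip configuration is a vector $\sigma$ of non-negative integers indexed by the non-sink vertices. A non-sink vertex $v$ is active in $\sigma$ if $\sigma(v)\ge d_v$; an active vertex can fire, giving $\sigma'$ with $\sigma'(w)=\sigma(w)+a_{vw}$ for non-sink $w\neq v$ and $\sigma'(v)=\sigma(v)-d_v+a_{vv}$. A configuration is stable if no vertex is active. A chip configuration $\sigma$ is accessible if from any other chip configuration it is possible to obtain $\sigma$ by a combination of adding chips and selectively firing active vertices. A chip configuration that is both stable and accessible is called recurrent. Rotor-routing: for each non-sink vertex $v$ a cyclic ordering of the edges emanating from $v$ is fixed, and $e^+$ denotes the edge following $e$ in it. A rotor configuration is a function $\rho$ assigning to each non-sink vertex $v$ an edge $\rho(v)$ emanating from $v$. It is acyclic if the edges $\rho(v)$ do not form any directed cycle. Routing a chip at a non-sink vertex $v$ for one step means replacing $\rho(v)$ by $\rho(v)^+$ and then moving the chip to the head of $\rho(v)^+$. For a non-sink vertex $v$, the chip addition operator $E_v$ is the map on rotor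 configurations given by adding a chip at $v$ and routing it repeatedly until it reaches the sink (which always happens after finitely many steps). The operators $E_v$ commute. For a chip configuration $\sigma$ and a rotor configuration $\rho$, $\sigma(\rho)=\left(\prod_{v\neq s}E_v^{\sigma(v)}\right)\rho$ (composition of operators). *)

theory Defs
  imports
    "Graph_Theory.Digraph"
    "Graph_Theory.Arc_Walk"
    "HOL-Combinatorics.Orbits"
    "HOL-Library.FuncSet"
    "HOL-Library.While_Combinator"
begin

definition sink :: "('v, 'e) pre_digraph \<Rightarrow> 'v \<Rightarrow> bool" where
  "sink G s \<longleftrightarrow> s \<in> verts G \<and> out_degree G s = 0"

definition global_sink :: "('v, 'e) pre_digraph \<Rightarrow> 'v \<Rightarrow> bool" where
  "global_sink G s \<longleftrightarrow> sink G s \<and> (\<forall>v \<in> verts G. v \<noteq> s \<longrightarrow> v \<rightarrow>\<^sup>*\<^bsub>G\<^esub> s)"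

definition nonsinks :: "('v, 'e) pre_digraph \<Rightarrow> 'v set" where
  "nonsinks G = {v \<in> verts G. \<not> sink G v}"

definition edge_count :: "('v, 'e) pre_digraph \<Rightarrow> 'v \<Rightarrow> 'v \<Rightarrow> nat" where
  "edge_count G v w = card {e \<in> arcs G. tail G e = v \<and> head G e = w}"


subsection \<open>Chip-firing\<close>

(* Vectors indexed by the non-sink vertices are represented by functions that vanish
   everywhere else, so equality of configurations is equality of functions. *)
definition chip_configs :: "('v, 'e) pre_digraph \<Rightarrow> ('v \<Rightarrow> nat) set" where
  "chip_configs G = {\<sigma>. \<forall>v. v \<notin> nonsinks G \<longrightarrow> \<sigma> v = 0}"

definition active :: "('v, 'e) pre_digraph \<Rightarrow> ('v \<Rightarrow> nat) \<Rightarrow> 'v \<Rightarrow> bool" where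
  "active G \<sigma> v \<longleftrightarrow> v \<in> nonsinks G \<and> out_degree G v \<le> \<sigma> v"

definition fire :: "('v, 'e) pre_digraph \<Rightarrow> 'v \<Rightarrow> ('v \<Rightarrow> nat) \<Rightarrow> ('v \<Rightarrow> nat)" where
  "fire G v \<sigma> = (\<lambda>w. if w = v then \<sigma> v - out_degree G v + edge_count G v v
                       else if w \<in> nonsinks G then \<sigma> w + edge_count G v w
                       else 0)"

definition stable :: "('v, 'e) pre_digraph \<Rightarrow> ('v \<Rightarrow> nat) \<Rightarrow> bool" where
  "stable G \<sigma> \<longleftrightarrow> (\<forall>v. \<not> active G \<sigma> v)"

inductive chip_move :: "('v, 'e) pre_digraph \<Rightarrow> ('v \<Rightarrow> nat) \<Rightarrow> ('v \<Rightarrow> nat) \<Rightarrow> bool"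
  for G :: "('v, 'e) pre_digraph" where
  add_chip: "v \<in> nonsinks G \<Longrightarrow> chip_move G \<sigma> (\<sigma>(v := \<sigma> v + 1))"
| fire_active: "active G \<sigma> v \<Longrightarrow> chip_move G \<sigma> (fire G v \<sigma>)"

definition accessible :: "('v, 'e) pre_digraph \<Rightarrow> ('v \<Rightarrow> nat) \<Rightarrow> bool" where
  "accessible G \<sigma> \<longleftrightarrow>
     \<sigma> \<in> chip_configs G \<and> (\<forall>\<tau> \<in> chip_configs G. (chip_move G)\<^sup>*\<^sup>* \<tau> \<sigma>)"

definition recurrent :: "('v, 'e) pre_digraph \<Rightarrow> ('v \<Rightarrow> nat) \<Rightarrow> bool" where
  "recurrent G \<sigma> \<longleftrightarrow> stable G \<sigma> \<and> accessible G \<sigma>"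


subsection \<open>Rotor-routing\<close>

(* nxt e is the edge following e in the cyclic ordering of the edges with the same tail. *)
definition rotor_ordering :: "('v, 'e) pre_digraph \<Rightarrow> ('e \<Rightarrow> 'e) \<Rightarrow> bool" where
  "rotor_ordering G nxt \<longleftrightarrow> (\<forall>v \<in> nonsinks G. cyclic_on nxt (out_arcs G v))"

definition rotor_configs :: "('v, 'e) pre_digraph \<Rightarrow> ('v \<Rightarrow> 'e) set" where
  "rotor_configs G = (\<Pi>\<^sub>E v \<in> nonsinks G. out_arcs G v)"

(* The library's notion of cycle includes self-loops. *)
definition acyclic_rotor :: "('v, 'e) pre_digraph \<Rightarrow> ('v \<Rightarrow> 'e) \<Rightarrow> bool" where
  "acyclic_rotor G \<rho> \<longleftrightarrow> \<not> (\<exists>p. pre_digraph.cycle G p \<and> set p \<subseteq> \<rho> ` nonsinks G)"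

definition route_step ::
  "('v, 'e) pre_digraph \<Rightarrow> ('e \<Rightarrow> 'e) \<Rightarrow> ('v \<Rightarrow> 'e) \<times> 'v \<Rightarrow> ('v \<Rightarrow> 'e) \<times> 'v" where
  "route_step G nxt = (\<lambda>(\<rho>, v). (\<rho>(v := nxt (\<rho> v)), head G (nxt (\<rho> v))))"

definition chip_addition ::
  "('v, 'e) pre_digraph \<Rightarrow> ('e \<Rightarrow> 'e) \<Rightarrow> 'v \<Rightarrow> ('v \<Rightarrow> 'e) \<Rightarrow> ('v \<Rightarrow> 'e)" where
  "chip_addition G nxt v \<rho> = fst (while (\<lambda>(_, w). \<not> sink G w) (route_step G nxt) (\<rho>, v))"

(* The composition of the operators over the finite set of non-sink vertices; its order is
   immaterial because the chip addition operators commute on rotor configurations. *)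
definition chip_action ::
  "('v, 'e) pre_digraph \<Rightarrow> ('e \<Rightarrow> 'e) \<Rightarrow> ('v \<Rightarrow> nat) \<Rightarrow> ('v \<Rightarrow> 'e) \<Rightarrow> ('v \<Rightarrow> 'e)" where
  "chip_action G nxt \<sigma> \<rho> =
     Finite_Set.fold (\<lambda>v. chip_addition G nxt v ^^ \<sigma> v) \<rho> (nonsinks G)"

end

theory Submission
  imports Defs
begin

text \<open>
  Route the chips of \<open>\<sigma>\<close> to the sink and let \<open>u v\<close> count the departures from \<open>v\<close>. The final rotor at
  \<open>v\<close> is the initial one advanced \<open>u v\<close> times, so if \<open>\<sigma>\<^sub>1\<close> and \<open>\<sigma>\<^sub>2\<close> lead to the same rotors then their
  counts differ at \<open>v\<close> by a multiple \<open>c v\<close> of the out-degree, and every arc out of \<open>v\<close> carries exactly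
  \<open>c v\<close> more chips in the first routing. Conservation of chips gives \<open>\<sigma>\<^sub>1 - \<sigma>\<^sub>2 = \<Delta> c\<close> with \<open>\<Delta>\<close> the
  Laplacian. A recurrent configuration is reachable from configurations so large that every vertex fires
  more than \<open>\<bar>c\<bar>\<close> times on the way; the least action principle applied to the odometer shifted by
  \<open>c\<close> yields \<open>c \<le> 0\<close>, and by symmetry \<open>c = 0\<close>. The least action principle for rotor-routing also shows
  that chip additions commute.
\<close>

section \<open>Sums along a cyclic orbit\<close>

lemma sum_lessThan_add:
  fixes f :: "nat \<Rightarrow> 'a::comm_monoid_add"
  shows "(\<Sum>i<a + b. f i) = (\<Sum>i<a. f i) + (\<Sum>i<b. f (a + i))"
  by (induction b) (simp_all add: add.assoc)

text \<open>With \<open>N\<close> the least positive return time of \<open>x\<close>, the first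
  \<open>N\<close> iterates are distinct and exhaust the orbit, so \<open>N = card S\<close>; every
  return time reduces modulo \<open>N\<close> to 0.\<close>

lemma cyclic_on_funpow_period:
  assumes "cyclic_on f S" "x \<in> S"
  shows "bij_betw (\<lambda>i. (f ^^ i) x) {..<card S} S" "(f ^^ k) x = x \<Longrightarrow> card S dvd k"
    "(f ^^ card S) x = x"
proof -
  have S: "S = orbit f x" using assms by (simp add: orbit_cyclic_eq3)
  then obtain n0 where "0 < n0" "(f ^^ n0) x = x"
    using assms by (auto simp: orbit_altdef)
  then have ex: "\<exists>n. 0 < n \<and> (f ^^ n) x = x" by blast
  define N where "N = (LEAST n. 0 < n \<and> (f ^^ n) x = x)"
  have N: "0 < N" "(f ^^ N) x = x"
    using LeastI_ex[OF ex] by (auto simp: N_def)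
  have least: "(f ^^ m) x \<noteq> x" if "0 < m" "m < N" for m
    using not_less_Least[of m] that by (auto simp: N_def)
  have neq: "(f ^^ i) x \<noteq> (f ^^ j) x" if "i < j" "j < N" for i j
  proof
    assume eq: "(f ^^ i) x = (f ^^ j) x"
    have "(f ^^ (N - j + i)) x = (f ^^ (N - j)) ((f ^^ j) x)"
      by (simp only: funpow_add o_apply eq)
    also have "\<dots> = (f ^^ (N - j + j)) x" by (simp only: funpow_add o_apply)
    also have "\<dots> = x" using that N by simp
    finally show False using least[of "N - j + i"] that by linarith
  qed
  have inj: "inj_on (\<lambda>i. (f ^^ i) x) {..<N}"
    by (rule inj_onI) (metis lessThan_iff linorder_neqE_nat neq)
  have im: "(\<lambda>i. (f ^^ i) x) ` {..<N} = S"
    unfolding S orbit_altdef_bounded[OF N(2,1)] by auto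
  have card: "card S = N" using card_image[OF inj] im by simp
  show "bij_betw (\<lambda>i. (f ^^ i) x) {..<card S} S"
    using inj im by (simp add: bij_betw_def card)
  show "(f ^^ card S) x = x" using N card by simp
  assume "(f ^^ k) x = x"
  then have "(f ^^ (k mod N)) x = x" using funpow_mod_eq[OF N(2), of k] by simp
  then have "k mod N = 0" using least[of "k mod N"] N(1) by auto
  then show "card S dvd k" by (simp add: card mod_0_imp_dvd)
qed

text \<open>Each block of \<open>card S\<close> consecutive iterates visits \<open>S\<close> exactly
  once. Sums start at \<open>Suc i\<close> because a rotor turns before the chip leaves.\<close>

lemma sum_funpow_cyclic_on:
  fixes g :: "'a \<Rightarrow> nat"
  assumes "cyclic_on f S" "x \<in> S"
  shows "(\<Sum>i<card S * k. g ((f ^^ Suc i) x)) = k * sum g S"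
proof (induction k)
  case (Suc k)
  have per: "(f ^^ (card S * k)) x = x"
    using cyclic_on_funpow_period(3)[OF assms] by (induction k) (auto simp: funpow_add)
  have fx: "f x \<in> S" using assms by (rule cyclic_on_inI)
  have "(\<Sum>i<card S. g ((f ^^ Suc (card S * k + i)) x)) = (\<Sum>i<card S. g ((f ^^ i) (f x)))"
    by (intro sum.cong refl)
      (metis (no_types, opaque_lifting) per add.commute add_Suc funpow_add funpow_swap1 o_apply funpow.simps(2))
  also have "\<dots> = sum g S"
    by (rule sum.reindex_bij_betw[OF cyclic_on_funpow_period(1)[OF assms(1) fx]])
  finally show ?case
    using Suc.IH by (simp only: mult_Suc_right add.commute[of "card S"] sum_lessThan_add) simp
qed simp

text \<open>Two exponents reaching the same point differ by \<open>c\<close> full turns, and each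
  turn contributes \<open>sum g S\<close>. Either exponent may be the larger, so \<open>c\<close> is
  an integer; one \<open>c\<close> serves all \<open>g\<close>.\<close>

lemma cyclic_on_funpow_eqD:
  fixes a b :: nat
  assumes "cyclic_on f S" "x \<in> S" "(f ^^ a) x = (f ^^ b) x"
  shows "\<exists>c::int. int a = int b + c * int (card S) \<and>
    (\<forall>g :: 'a \<Rightarrow> nat. int (\<Sum>i<a. g ((f ^^ Suc i) x)) = int (\<Sum>i<b. g ((f ^^ Suc i) x)) + c * int (sum g S))"
proof -
  have *: "\<exists>k. a = b + card S * k \<and>
    (\<forall>g :: 'a \<Rightarrow> nat. (\<Sum>i<a. g ((f ^^ Suc i) x)) = (\<Sum>i<b. g ((f ^^ Suc i) x)) + k * sum g S)"
    if le: "b \<le> a" and eq: "(f ^^ a) x = (f ^^ b) x" for a b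
  proof -
    define y where "y = (f ^^ b) x"
    have y: "y \<in> S" unfolding y_def by (rule cyclic_on_funpow_in[OF assms(1,2)])
    have "(f ^^ (a - b)) y = y"
      using eq le by (metis y_def funpow_add le_add_diff_inverse2 o_apply)
    then have "card S dvd a - b" by (rule cyclic_on_funpow_period(2)[OF assms(1) y])
    then obtain k where "a - b = card S * k" by blast
    then have a: "a = b + card S * k" using le by simp
    have "(\<Sum>i<a. g ((f ^^ Suc i) x)) = (\<Sum>i<b. g ((f ^^ Suc i) x)) + k * sum g S" for g :: "'a \<Rightarrow> nat"
    proof -
      have "(\<Sum>i<card S * k. g ((f ^^ Suc (b + i)) x)) = (\<Sum>i<card S * k. g ((f ^^ Suc i) y))"
        by (intro sum.cong refl) (metis y_def add.commute add_Suc funpow_add o_apply)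
      then show ?thesis
        by (simp only: a sum_lessThan_add sum_funpow_cyclic_on[OF assms(1) y])
    qed
    with a show ?thesis by blast
  qed
  show ?thesis
  proof (cases "b \<le> a")
    case True
    obtain k where k: "a = b + card S * k"
      "\<forall>g :: 'a \<Rightarrow> nat. (\<Sum>i<a. g ((f ^^ Suc i) x)) = (\<Sum>i<b. g ((f ^^ Suc i) x)) + k * sum g S"
      using *[OF True assms(3)] by blast
    show ?thesis
      by (rule exI[of _ "int k"]) (simp only: k(1)[THEN arg_cong, of int] k(2) of_nat_add of_nat_mult mult.commute simp_thms)
  next
    case False
    then have "a \<le> b" by simp
    from *[OF this assms(3)[symmetric]] obtain k where k: "b = a + card S * k"
      "\<forall>g :: 'a \<Rightarrow> nat. (\<Sum>i<b. g ((f ^^ Suc i) x)) = (\<Sum>i<a. g ((f ^^ Suc i) x)) + k * sum g S"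
      by blast
    have "int a = int b + (- int k) * int (card S)" using k(1) by simp
    moreover have "int (\<Sum>i<a. g ((f ^^ Suc i) x)) = int (\<Sum>i<b. g ((f ^^ Suc i) x)) + (- int k) * int (sum g S)"
      for g :: "'a \<Rightarrow> nat"
      unfolding k(2)[rule_format, of g] by simp
    ultimately show ?thesis by blast
  qed
qed


section \<open>Uniqueness of the recurrent configuration in a Laplacian class\<close>

text \<open>Firing each non-sink \<open>v\<close> exactly \<open>c v\<close> times subtracts this
  vector. Loops occur in both terms, so the diagonal entry is the out-degree minus the number of
  loops.\<close>

definition laplacian :: "('v, 'e) pre_digraph \<Rightarrow> ('v \<Rightarrow> int) \<Rightarrow> 'v \<Rightarrow> int" where
  "laplacian G c w =
     int (out_degree G w) * c w - (\<Sum>x\<in>nonsinks G. c x * int (edge_count G x w))"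

lemma laplacian_diff:
  "laplacian G (\<lambda>v. a v - b v) w = laplacian G a w - laplacian G b w"
  by (simp add: laplacian_def algebra_simps sum_subtractf)

lemma laplacian_uminus: "laplacian G (\<lambda>v. - c v) w = - laplacian G c w"
  by (simp add: laplacian_def sum_negf)

lemma laplacian_cong:
  assumes "w \<in> nonsinks G" "\<And>v. v \<in> nonsinks G \<Longrightarrow> a v = b v"
  shows "laplacian G a w = laplacian G b w"
  using assms by (simp add: laplacian_def cong: sum.cong)

context fin_digraph
begin

lemma finite_nonsinks: "finite (nonsinks G)"
  by (simp add: nonsinks_def)

lemma laplacian_Suc:
  assumes "x \<in> nonsinks G"
  shows "laplacian G (\<lambda>v. int ((u(x := Suc (u x))) v)) w =
    laplacian G (\<lambda>v. int (u v)) w + of_bool (w = x) * int (out_degree G x) - int (edge_count G x w)"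
proof -
  have "(\<Sum>v\<in>nonsinks G. int ((u(x := Suc (u x))) v) * int (edge_count G v w))
    = (\<Sum>v\<in>nonsinks G. int (u v) * int (edge_count G v w)) + int (edge_count G x w)"
    by (subst (1 2) sum.remove[OF finite_nonsinks assms]) (simp add: algebra_simps)
  then show ?thesis by (simp add: laplacian_def algebra_simps)
qed

text \<open>The last conjunct is the least action principle: the firing vector of a legal sequence is
  below every firing vector that leads to a stable integer vector, even after further additions.\<close>

lemma chip_moves_odometer:
  assumes "(chip_move G)\<^sup>*\<^sup>* \<tau> \<sigma>"
  shows "\<exists>a u :: 'a \<Rightarrow> nat.
    (\<forall>w\<in>nonsinks G. int (\<sigma> w) = int (\<tau> w + a w) - laplacian G (\<lambda>v. int (u v)) w) \<and>
    (\<forall>b v. (\<forall>w. a w \<le> b w) \<longrightarrow>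
       (\<forall>w\<in>nonsinks G. int (\<tau> w + b w) - laplacian G (\<lambda>z. int (v z)) w < int (out_degree G w)) \<longrightarrow>
       (\<forall>w\<in>nonsinks G. u w \<le> v w))"
  using assms
proof (induction rule: rtranclp_induct)
  case base
  show ?case
    by (rule exI[of _ "\<lambda>_. 0"], rule exI[of _ "\<lambda>_. 0"]) (simp add: laplacian_def)
next
  case (step \<sigma> \<sigma>')
  then obtain a u :: "'a \<Rightarrow> nat" where
    eq: "\<And>w. w \<in> nonsinks G \<Longrightarrow> int (\<sigma> w) = int (\<tau> w + a w) - laplacian G (\<lambda>v. int (u v)) w" and
    least: "\<And>b v w. (\<forall>w. a w \<le> b w) \<Longrightarrow>
       (\<forall>w\<in>nonsinks G. int (\<tau> w + b w) - laplacian G (\<lambda>z. int (v z)) w < int (out_degree G w)) \<Longrightarrow>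
       w \<in> nonsinks G \<Longrightarrow> u w \<le> v w"
    by blast
  from step.hyps(2) show ?case
  proof cases
    case (add_chip x)
    show ?thesis
    proof (rule exI[of _ "a(x := a x + 1)"], rule exI[of _ u], intro conjI allI impI ballI)
      fix w assume "w \<in> nonsinks G"
      then show "int (\<sigma>' w) = int (\<tau> w + (a(x := a x + 1)) w) - laplacian G (\<lambda>v. int (u v)) w"
        using eq[of w] add_chip by auto
    next
      fix b v :: "'a \<Rightarrow> nat" and w
      assume "\<forall>w. (a(x := a x + 1)) w \<le> b w"
      then have "a w \<le> b w" for w
        by (drule_tac spec[of _ w]) (auto split: if_splits)
      moreover assume "\<forall>w\<in>nonsinks G. int (\<tau> w + b w) - laplacian G (\<lambda>z. int (v z)) w < int (out_degree G w)"
        "w \<in> nonsinks G"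
      ultimately show "u w \<le> v w" using least by blast
    qed
  next
    case (fire_active x)
    then have x: "x \<in> nonsinks G" and act: "out_degree G x \<le> \<sigma> x" by (auto simp: active_def)
    show ?thesis
    proof (rule exI[of _ a], rule exI[of _ "u(x := Suc (u x))"], intro conjI allI impI ballI)
      fix w assume "w \<in> nonsinks G"
      then show "int (\<sigma>' w) = int (\<tau> w + a w) - laplacian G (\<lambda>v. int ((u(x := Suc (u x))) v)) w"
        using eq[of w] act unfolding laplacian_Suc[OF x] fire_active by (auto simp: fire_def)
    next
      fix b v :: "'a \<Rightarrow> nat" and w
      assume b: "\<forall>w. a w \<le> b w" and
        v: "\<forall>w\<in>nonsinks G. int (\<tau> w + b w) - laplacian G (\<lambda>z. int (v z)) w < int (out_degree G w)"
        and w: "w \<in> nonsinks G"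
      have le: "u w \<le> v w" if "w \<in> nonsinks G" for w using least[OF b v that] .
      \<comment> \<open>With equal counts at \<open>x\<close> and \<open>u \<le> v\<close>
        elsewhere, \<open>x\<close> would end with at least \<open>\<sigma> x\<close> chips, which
        is enough to be active, against the bound assumed for \<open>v\<close>.\<close>
      have "u x \<noteq> v x"
      proof
        assume ux: "u x = v x"
        have "laplacian G (\<lambda>z. int (v z)) x \<le> laplacian G (\<lambda>v. int (u v)) x"
          unfolding laplacian_def ux
          by (intro diff_mono order.refl sum_mono mult_right_mono) (auto simp: le)
        moreover have "a x \<le> b x" using b by blast
        ultimately show False using v[rule_format, OF x] eq[OF x] act by linarith
      qed
      then show "(u(x := Suc (u x))) w \<le> v w" using le[OF x] le[OF w] by auto
    qed
  qed
qed

lemma out_degree_pos: "v \<in> nonsinks G \<Longrightarrow> 0 < out_degree G v"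
  by (auto simp: nonsinks_def sink_def)

lemma stable_less: "stable G \<sigma> \<Longrightarrow> w \<in> nonsinks G \<Longrightarrow> \<sigma> w < out_degree G w"
  by (metis active_def not_le stable_def)

text \<open>Reach \<open>\<sigma>\<close> from a configuration so large that every vertex fires often enough for the
  odometer minus \<open>c\<close> to stay nonnegative; the least action principle then compares the two.\<close>

lemma recurrent_laplacian_nonpos:
  assumes "recurrent G \<sigma>" "stable G \<sigma>'" and
    diff: "\<And>w. w \<in> nonsinks G \<Longrightarrow> int (\<sigma>' w) = int (\<sigma> w) + laplacian G c w"
    and z: "z \<in> nonsinks G"
  shows "c z \<le> 0"
proof -
  define K where "K = (\<Sum>w\<in>nonsinks G. nat \<bar>c w\<bar>)"
  \<comment> \<open>A firing of \<open>w\<close> removes at most its out-degree, so descending from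
    \<open>K + 1\<close> times the out-degree to below it takes more than \<open>K\<close> firings;
    arriving chips only raise that number.\<close>
  define \<tau> where "\<tau> = (\<lambda>w. if w \<in> nonsinks G then out_degree G w * (K + 1) else 0)"
  have K: "\<bar>c w\<bar> \<le> int K" if "w \<in> nonsinks G" for w
  proof -
    have "nat \<bar>c w\<bar> \<le> K" unfolding K_def by (rule member_le_sum[OF that]) (simp_all add: finite_nonsinks)
    then show ?thesis by linarith
  qed
  have "\<tau> \<in> chip_configs G" by (simp add: chip_configs_def \<tau>_def)
  then have "(chip_move G)\<^sup>*\<^sup>* \<tau> \<sigma>"
    using assms(1) by (auto simp: recurrent_def accessible_def)
  from chip_moves_odometer[OF this] obtain a u :: "'a \<Rightarrow> nat" where
    eq: "\<And>w. w \<in> nonsinks G \<Longrightarrow> int (\<sigma> w) = int (\<tau> w + a w) - laplacian G (\<lambda>v. int (u v)) w" and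
    least: "\<And>b v w. (\<forall>w. a w \<le> b w) \<Longrightarrow>
       (\<forall>w\<in>nonsinks G. int (\<tau> w + b w) - laplacian G (\<lambda>z. int (v z)) w < int (out_degree G w)) \<Longrightarrow>
       w \<in> nonsinks G \<Longrightarrow> u w \<le> v w"
    by blast
  have large: "K < u w" if w: "w \<in> nonsinks G" for w
  proof -
    let ?d = "out_degree G w"
    have "\<sigma> w < ?d" using assms(1) w by (auto simp: recurrent_def intro: stable_less)
    moreover have "laplacian G (\<lambda>v. int (u v)) w \<le> int ?d * int (u w)"
      by (simp add: laplacian_def sum_nonneg)
    ultimately have "int (\<tau> w) - int ?d * int (u w) < int ?d" using eq[OF w] by linarith
    then have "int ?d * int K < int ?d * int (u w)" using w by (simp add: \<tau>_def algebra_simps)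
    then show ?thesis by (metis mult_less_cancel_left_pos of_nat_less_iff of_nat_0_less_iff out_degree_pos w)
  qed
  \<comment> \<open>These firings carry \<open>\<tau> + a\<close> to the stable
    \<open>\<sigma>'\<close> in place of \<open>\<sigma>\<close>, so least action gives
    \<open>u \<le> u - c\<close>. On the non-sinks \<open>u\<close> exceeds
    \<open>\<bar>c\<bar>\<close>, hence \<open>nat\<close> truncates nothing there.\<close>
  define v where "v = (\<lambda>w. nat (int (u w) - c w))"
  have v: "int (v w) = int (u w) - c w" if "w \<in> nonsinks G" for w
    using K[OF that] large[OF that] by (simp add: v_def)
  have "int (\<tau> w + a w) - laplacian G (\<lambda>x. int (v x)) w < int (out_degree G w)"
    if w: "w \<in> nonsinks G" for w
  proof -
    have "laplacian G (\<lambda>x. int (v x)) w = laplacian G (\<lambda>v. int (u v)) w - laplacian G c w"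
      unfolding laplacian_diff[symmetric] using w by (rule laplacian_cong) (rule v)
    then show ?thesis using eq[OF w] diff[OF w] stable_less[OF assms(2) w] by linarith
  qed
  then have "u z \<le> v z" using least[of a v z] z by blast
  then show ?thesis using v[OF z] by linarith
qed

lemma recurrent_laplacian_unique:
  assumes "recurrent G \<sigma>\<^sub>1" "recurrent G \<sigma>\<^sub>2"
    and diff: "\<And>w. w \<in> nonsinks G \<Longrightarrow> int (\<sigma>\<^sub>1 w) = int (\<sigma>\<^sub>2 w) + laplacian G c w"
  shows "\<sigma>\<^sub>1 = \<sigma>\<^sub>2"
proof
  fix w
  have st: "stable G \<sigma>\<^sub>1" "stable G \<sigma>\<^sub>2" using assms by (auto simp: recurrent_def)
  have c: "c z = 0" if "z \<in> nonsinks G" for z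
  proof -
    have "c z \<le> 0" using recurrent_laplacian_nonpos[OF assms(2) st(1) diff that] .
    \<comment> \<open>Exchanging the roles of the two configurations replaces \<open>c\<close> by
      \<open>- c\<close>.\<close>
    moreover have "- c z \<le> 0"
      by (rule recurrent_laplacian_nonpos[OF assms(1) st(2), of "\<lambda>v. - c v"])
        (simp_all add: laplacian_uminus diff that)
    ultimately show ?thesis by simp
  qed
  show "\<sigma>\<^sub>1 w = \<sigma>\<^sub>2 w"
  proof (cases "w \<in> nonsinks G")
    case True
    then have "laplacian G c w = 0" using c by (simp add: laplacian_def)
    then show ?thesis using diff[OF True] by simp
  next
    case False
    then show ?thesis using assms by (simp add: recurrent_def accessible_def chip_configs_def)
  qed
qed

end


section \<open>Odometers of rotor-routing\<close>

locale rotor_router = fin_digraph G for G :: "('a, 'b) pre_digraph" +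
  fixes s :: 'a and nxt :: "'b \<Rightarrow> 'b"
  assumes global_sink: "global_sink G s"
    and rotor_ordering: "rotor_ordering G nxt"
begin

definition advance :: "('a \<Rightarrow> 'b) \<Rightarrow> ('a \<Rightarrow> nat) \<Rightarrow> 'a \<Rightarrow> 'b" where
  "advance \<rho> u = (\<lambda>v. (nxt ^^ u v) (\<rho> v))"

text \<open>Departure number \<open>i\<close> from \<open>v\<close>, counted from 0, uses the arc
  \<open>(nxt ^^ Suc i) (\<rho> v)\<close>.\<close>

definition inflow :: "('a \<Rightarrow> 'b) \<Rightarrow> ('a \<Rightarrow> nat) \<Rightarrow> 'a \<Rightarrow> nat" where
  "inflow \<rho> u w = (\<Sum>v\<in>nonsinks G. \<Sum>i<u v. of_bool (head G ((nxt ^^ Suc i) (\<rho> v)) = w))"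

text \<open>\<open>routes \<rho> \<sigma> u \<sigma>'\<close> says that the chips \<open>\<sigma>\<close> can be routed to \<open>\<sigma>'\<close> with odometer \<open>u\<close>. Legality of
  the routing is replaced by the least action principle, which determines \<open>u\<close> when \<open>\<sigma>' = 0\<close>.\<close>

definition routes :: "('a \<Rightarrow> 'b) \<Rightarrow> ('a \<Rightarrow> nat) \<Rightarrow> ('a \<Rightarrow> nat) \<Rightarrow> ('a \<Rightarrow> nat) \<Rightarrow> bool" where
  "routes \<rho> \<sigma> u \<sigma>' \<longleftrightarrow>
     (\<forall>v. v \<notin> nonsinks G \<longrightarrow> u v = 0) \<and>
     (\<forall>w\<in>nonsinks G. \<sigma> w + inflow \<rho> u w = u w + \<sigma>' w) \<and>
     (\<forall>x. (\<forall>w\<in>nonsinks G. \<sigma> w + inflow \<rho> x w \<le> x w) \<longrightarrow> (\<forall>w\<in>nonsinks G. u w \<le> x w))"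

lemma advance_add: "advance \<rho> (\<lambda>v. a v + b v) = advance (advance \<rho> a) b"
proof -
  have "(nxt ^^ (m + n)) e = (nxt ^^ n) ((nxt ^^ m) e)" for m n e
    by (subst add.commute) (simp add: funpow_add)
  then show ?thesis by (simp add: advance_def)
qed

lemma inflow_add: "inflow \<rho> (\<lambda>v. a v + b v) w = inflow \<rho> a w + inflow (advance \<rho> a) b w"
proof -
  have "(nxt ^^ Suc (n + i)) e = (nxt ^^ Suc i) ((nxt ^^ n) e)" for n i e
    by (metis add.commute add_Suc funpow_add o_apply)
  then show ?thesis
    by (simp only: inflow_def advance_def sum_lessThan_add sum.distrib)
qed

lemma inflow_cong:
  assumes "\<And>v. v \<in> nonsinks G \<Longrightarrow> a v = b v"
  shows "inflow \<rho> a w = inflow \<rho> b w"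
  unfolding inflow_def by (rule sum.cong) (simp_all add: assms)

lemma inflow_0 [simp]: "inflow \<rho> (\<lambda>_. 0) w = 0"
  by (simp add: inflow_def)

lemma routes_0: "routes \<rho> (\<lambda>_. 0) (\<lambda>_. 0) (\<lambda>_. 0)"
  by (simp add: routes_def)

text \<open>A competitor \<open>x\<close> for the whole routing is one for the first stage, so
  \<open>u \<le> x\<close>; the rest \<open>x - u\<close> then competes in the second stage from the
  advanced rotors, so \<open>u' \<le> x - u\<close>. The chips \<open>\<tau>\<close> join between
  the stages.\<close>

lemma routes_trans:
  assumes 1: "routes \<rho> \<sigma> u \<sigma>'" and 2: "routes (advance \<rho> u) (\<lambda>w. \<sigma>' w + \<tau> w) u' \<sigma>''"
  shows "routes \<rho> (\<lambda>w. \<sigma> w + \<tau> w) (\<lambda>w. u w + u' w) \<sigma>''"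
  unfolding routes_def
proof (intro conjI allI impI ballI)
  fix v assume "v \<notin> nonsinks G"
  then show "u v + u' v = 0" using 1 2 by (simp add: routes_def)
next
  fix w assume w: "w \<in> nonsinks G"
  have "\<sigma> w + inflow \<rho> u w = u w + \<sigma>' w" using 1 w by (simp add: routes_def)
  moreover have "\<sigma>' w + \<tau> w + inflow (advance \<rho> u) u' w = u' w + \<sigma>'' w"
    using 2 w by (simp add: routes_def)
  ultimately show "\<sigma> w + \<tau> w + inflow \<rho> (\<lambda>w. u w + u' w) w = u w + u' w + \<sigma>'' w"
    by (simp add: inflow_add)
next
  fix x w
  assume x: "\<forall>w\<in>nonsinks G. \<sigma> w + \<tau> w + inflow \<rho> x w \<le> x w" and w: "w \<in> nonsinks G"
  have "\<forall>w\<in>nonsinks G. \<sigma> w + inflow \<rho> x w \<le> x w" using x by fastforce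
  then have le: "u w \<le> x w" if "w \<in> nonsinks G" for w using 1 that unfolding routes_def by blast
  \<comment> \<open>By \<open>le\<close> this subtraction of naturals is exact on the
    non-sinks.\<close>
  define y where "y = (\<lambda>w. x w - u w)"
  have xy: "x w = u w + y w" if "w \<in> nonsinks G" for w using le[OF that] by (simp add: y_def)
  have "\<sigma>' w + \<tau> w + inflow (advance \<rho> u) y w \<le> y w" if w: "w \<in> nonsinks G" for w
  proof -
    have "inflow \<rho> x w = inflow \<rho> u w + inflow (advance \<rho> u) y w"
      using inflow_cong[of x "\<lambda>w. u w + y w", OF xy] by (simp add: inflow_add)
    moreover have "\<sigma> w + inflow \<rho> u w = u w + \<sigma>' w" using 1 w by (simp add: routes_def)
    ultimately show ?thesis using x[rule_format, OF w] xy[OF w] by linarith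
  qed
  then have "u' w \<le> y w" using 2 w unfolding routes_def by blast
  then show "u w + u' w \<le> x w" using xy[OF w] by simp
qed

text \<open>With no chips left over, conservation makes each odometer a competitor in the other's
  minimality clause.\<close>

lemma routes_unique:
  assumes "routes \<rho> \<sigma> u (\<lambda>_. 0)" "routes \<rho> \<sigma> u' (\<lambda>_. 0)"
  shows "u = u'"
proof
  fix w
  show "u w = u' w"
  proof (cases "w \<in> nonsinks G")
    case True
    have "u w \<le> u' w" "u' w \<le> u w" using assms True by (simp_all add: routes_def)
    then show ?thesis by simp
  next
    case False
    then show ?thesis using assms by (simp add: routes_def)
  qed
qed

abbreviation unit :: "'a \<Rightarrow> 'a \<Rightarrow> nat" where
  "unit v \<equiv> (\<lambda>w. of_bool (w = v))"

lemma advance_unit: "advance \<rho> (unit v) = \<rho>(v := nxt (\<rho> v))"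
  by (auto simp: advance_def)

lemma inflow_unit:
  assumes "v \<in> nonsinks G"
  shows "inflow \<rho> (unit v) w = of_bool (head G (nxt (\<rho> v)) = w)"
proof -
  have "inflow \<rho> (unit v) w =
    (\<Sum>x\<in>nonsinks G. if x = v then of_bool (head G (nxt (\<rho> v)) = w) else 0)"
    unfolding inflow_def by (rule sum.cong) (simp_all only: of_bool_def, auto)
  then show ?thesis using assms by (simp add: finite_nonsinks)
qed

text \<open>Minimality holds because \<open>1 + inflow \<rho> x v \<le> x v\<close> forces
  \<open>1 \<le> x v\<close>.\<close>

lemma routes_unit:
  assumes "v \<in> nonsinks G"
  shows "routes \<rho> (unit v) (unit v) (unit (head G (nxt (\<rho> v))))"
  unfolding routes_def
proof (intro conjI allI impI ballI)
  fix w assume "w \<notin> nonsinks G"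
  then show "unit v w = 0" using assms by auto
next
  fix w assume "w \<in> nonsinks G"
  show "unit v w + inflow \<rho> (unit v) w = unit v w + unit (head G (nxt (\<rho> v))) w"
    using assms by (auto simp: inflow_unit)
next
  fix x w assume "\<forall>w\<in>nonsinks G. unit v w + inflow \<rho> x w \<le> x w" "w \<in> nonsinks G"
  then show "unit v w \<le> x w" by fastforce
qed

lemma nxt_out_arcs: "v \<in> nonsinks G \<Longrightarrow> e \<in> out_arcs G v \<Longrightarrow> nxt e \<in> out_arcs G v"
  using rotor_ordering by (metis cyclic_on_inI rotor_ordering_def)

lemma rotor_in_out_arcs: "\<rho> \<in> rotor_configs G \<Longrightarrow> v \<in> nonsinks G \<Longrightarrow> \<rho> v \<in> out_arcs G v"
  unfolding rotor_configs_def by (rule PiE_mem)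

lemma update_rotor_configs:
  assumes "\<rho> \<in> rotor_configs G" "v \<in> nonsinks G"
  shows "\<rho>(v := nxt (\<rho> v)) \<in> rotor_configs G"
  using assms nxt_out_arcs[OF assms(2) rotor_in_out_arcs[OF assms]]
  by (auto simp: rotor_configs_def PiE_iff extensional_def)

lemma advance_rotor_configs:
  assumes "\<rho> \<in> rotor_configs G" "routes \<rho> \<sigma> u \<sigma>'"
  shows "advance \<rho> u \<in> rotor_configs G"
proof -
  have "(nxt ^^ n) (\<rho> v) \<in> out_arcs G v" if "v \<in> nonsinks G" for n v
    using cyclic_on_funpow_in rotor_ordering rotor_in_out_arcs[OF assms(1) that] that
    unfolding rotor_ordering_def by metis
  moreover have "u v = 0" if "v \<notin> nonsinks G" for v using assms(2) that by (simp add: routes_def)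
  ultimately show ?thesis
    using assms(1)
    by (simp add: rotor_configs_def PiE_iff extensional_def advance_def del: in_out_arcs_conv)
qed

lemma head_cases:
  assumes "e \<in> out_arcs G v"
  shows "head G e \<in> nonsinks G \<or> sink G (head G e)"
  using assms by (auto simp: nonsinks_def)


section \<open>Chip addition terminates\<close>

text \<open>A walk avoiding the sinks visits some vertex infinitely often. Its rotor then passes infinitely
  often through every outgoing arc, so the set of such vertices is closed under successors and
  contains the global sink.\<close>

lemma route_terminates:
  assumes "\<rho> \<in> rotor_configs G" "v \<in> nonsinks G"
  shows "\<exists>k. sink G (snd ((route_step G nxt ^^ k) (\<rho>, v)))"
proof (rule ccontr)
  assume nosink: "\<not> ?thesis"
  define st where "st k = (route_step G nxt ^^ k) (\<rho>, v)" for k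
  define R where "R k = fst (st k)" for k
  define p where "p k = snd (st k)" for k
  have R_Suc: "R (Suc k) = (R k)(p k := nxt (R k (p k)))" for k
    by (simp add: R_def p_def st_def route_step_def case_prod_beta)
  have p_Suc: "p (Suc k) = head G (R (Suc k) (p k))" for k
    by (simp add: R_Suc) (simp add: R_def p_def st_def route_step_def case_prod_beta)
  have ns: "\<not> sink G (p k)" for k using nosink by (auto simp: p_def st_def)
  have inv: "R k \<in> rotor_configs G \<and> p k \<in> nonsinks G" for k
  proof (induction k)
    case 0
    then show ?case using assms by (simp add: R_def p_def st_def)
  next
    case (Suc k)
    then have "R (Suc k) \<in> rotor_configs G" unfolding R_Suc by (blast intro: update_rotor_configs)
    moreover from this have "R (Suc k) (p k) \<in> out_arcs G (p k)"
      using Suc rotor_in_out_arcs by blast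
    ultimately show ?case using head_cases ns[of "Suc k"] unfolding p_Suc by metis
  qed
  define I where "I = {w. \<exists>\<^sub>\<infinity>k. p k = w}"
  have ex: "\<exists>w. \<exists>\<^sub>\<infinity>k. p k = w"
  proof -
    have "finite (range p)" using finite_subset[OF _ finite_nonsinks] inv by blast
    from pigeonhole_infinite[OF infinite_UNIV_nat this] show ?thesis
      by (auto simp: INFM_iff_infinite)
  qed
  have I_iff: "w \<in> I \<longleftrightarrow> (\<forall>m. \<exists>k\<ge>m. p k = w)" for w
    unfolding I_def INFM_nat_le by simp
  from ex obtain w0 where w0: "w0 \<in> I" by (auto simp: I_def)
  have I_ns: "I \<subseteq> nonsinks G"
    using inv INFM_EX unfolding I_def by blast
  \<comment> \<open>The rotor at \<open>w\<close> changes only on departures from \<open>w\<close>,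
    so its value persists up to the next visit; this links consecutive visits in
    \<open>step\<close>.\<close>
  have wait: "(R (m + k) w = R m w) \<or> (\<exists>j\<ge>m. p j = w \<and> R j w = R m w)" for m k w
  proof (induction k)
    case (Suc k)
    then show ?case
      by (cases "p (m + k) = w") (auto simp: R_Suc intro: exI[of _ "m + k"])
  qed simp
  have closed: "head G e \<in> I" if w: "w \<in> I" and e: "e \<in> out_arcs G w" for w e
  proof -
    \<comment> \<open>The arcs by which the walk leaves \<open>w\<close> infinitely often;
      \<open>Suc k\<close> because the rotor turns first. Pigeonhole makes \<open>J\<close>
      nonempty, and the visit following a departure by \<open>e\<close> leaves by
      \<open>nxt e\<close>.\<close>
    define J where "J = {e. \<exists>\<^sub>\<infinity>k. p k = w \<and> R (Suc k) w = e}"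
    have J_iff: "e \<in> J \<longleftrightarrow> (\<forall>m. \<exists>k\<ge>m. p k = w \<and> R (Suc k) w = e)" for e
      unfolding J_def INFM_nat_le by simp
    have wn: "w \<in> nonsinks G" using w I_ns by blast
    have "finite ((\<lambda>k. R (Suc k) w) ` {k. p k = w})"
      by (rule finite_subset[OF _ finite_out_arcs[of w]]) (use inv rotor_in_out_arcs wn in blast)
    moreover have "infinite {k. p k = w}" using w by (simp add: I_def INFM_iff_infinite)
    ultimately obtain k where "infinite {a \<in> {k. p k = w}. R (Suc a) w = R (Suc k) w}"
      using pigeonhole_infinite by blast
    then have "R (Suc k) w \<in> J" by (simp add: J_def INFM_iff_infinite)
    then obtain e0 where e0: "e0 \<in> J" by blast
    have step: "nxt e \<in> J" if eJ: "e \<in> J" for e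
      unfolding J_iff
    proof
      fix m
      obtain k where k: "k \<ge> m" "p k = w" "R (Suc k) w = e"
        using eJ J_iff by meson
      obtain l where l: "l \<ge> Suc k" "p l = w"
        using w I_iff by meson
      have "\<exists>j\<ge>Suc k. p j = w \<and> R j w = e"
        using wait[of "Suc k" "l - Suc k" w] l k(3) by (metis le_add_diff_inverse)
      then obtain j where "j \<ge> Suc k" "p j = w" "R j w = e" by blast
      then show "\<exists>n\<ge>m. p n = w \<and> R (Suc n) w = nxt e"
        using k(1) by (intro exI[of _ j]) (auto simp: R_Suc)
    qed
    have "e0 \<in> out_arcs G w"
    proof -
      obtain k where "R (Suc k) w = e0" using INFM_EX e0 unfolding J_def by blast
      then show ?thesis using rotor_in_out_arcs inv wn by blast
    qed
    moreover have "cyclic_on nxt (out_arcs G w)"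
      using rotor_ordering wn by (simp add: rotor_ordering_def)
    ultimately have "e \<in> orbit nxt e0" using e by (simp add: orbit_cyclic_eq3)
    then have "e \<in> J" by induction (auto intro: step e0)
    show ?thesis unfolding I_iff
    proof
      fix m
      obtain k where "k \<ge> m" "p k = w" "R (Suc k) w = e"
        using \<open>e \<in> J\<close> J_iff by meson
      then show "\<exists>n\<ge>m. p n = head G e"
        by (intro exI[of _ "Suc k"]) (auto simp: p_Suc)
    qed
  qed
  have "w0 \<rightarrow>\<^sup>*\<^bsub>G\<^esub> s"
    using w0 I_ns global_sink by (auto simp: global_sink_def nonsinks_def)
  then have "w0 \<in> I \<longrightarrow> s \<in> I"
  proof (induction rule: converse_reachable_induct)
    case (step x y)
    then obtain e where "e \<in> out_arcs G x" "head G e = y"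
      by (auto simp: arcs_ends_def arc_to_ends_def)
    then show ?case using step.IH closed by blast
  qed simp
  then have "s \<in> nonsinks G" using w0 I_ns by blast
  then show False using global_sink by (simp add: global_sink_def nonsinks_def)
qed

section \<open>Chip addition expressed through odometers\<close>

lemma chip_addition_sink:
  assumes "sink G v"
  shows "routes \<rho> (unit v) (\<lambda>_. 0) (\<lambda>_. 0) \<and> chip_addition G nxt v \<rho> = advance \<rho> (\<lambda>_. 0)"
  using assms unfolding chip_addition_def
  by (subst while_unfold) (auto simp: routes_def nonsinks_def advance_def)

text \<open>Induction on the number of routing steps: the first step unfolds the
  \<open>while\<close> loop once and is glued to the rest by \<open>routes_trans\<close>.\<close>

lemma chip_addition_routes:
  assumes "\<rho> \<in> rotor_configs G" "v \<in> nonsinks G"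
  shows "\<exists>u. routes \<rho> (unit v) u (\<lambda>_. 0) \<and> chip_addition G nxt v \<rho> = advance \<rho> u"
proof -
  have "\<exists>u. routes \<rho> (unit v) u (\<lambda>_. 0) \<and> chip_addition G nxt v \<rho> = advance \<rho> u"
    if "sink G (snd ((route_step G nxt ^^ k) (\<rho>, v)))" "\<rho> \<in> rotor_configs G"
      "v \<in> nonsinks G \<or> sink G v" for k \<rho> v
    using that
  proof (induction k arbitrary: \<rho> v)
    case 0
    then show ?case using chip_addition_sink[of v \<rho>] by auto
  next
    case (Suc k \<rho> v)
    show ?case
    proof (cases "v \<in> nonsinks G")
      case True
      let ?\<rho>' = "\<rho>(v := nxt (\<rho> v))" and ?w = "head G (nxt (\<rho> v))"
      have "?\<rho>' \<in> rotor_configs G" using Suc.prems(2) True by (rule update_rotor_configs)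
      moreover have "?w \<in> nonsinks G \<or> sink G ?w"
        using nxt_out_arcs[OF True rotor_in_out_arcs[OF Suc.prems(2) True]] by (rule head_cases)
      moreover have "sink G (snd ((route_step G nxt ^^ k) (?\<rho>', ?w)))"
        using Suc.prems(1) by (simp add: funpow_swap1 route_step_def)
      ultimately obtain u where u: "routes ?\<rho>' (unit ?w) u (\<lambda>_. 0)"
        "chip_addition G nxt ?w ?\<rho>' = advance ?\<rho>' u"
        using Suc.IH by blast
      have "\<not> sink G v" using True by (simp add: nonsinks_def)
      then have "chip_addition G nxt v \<rho> = chip_addition G nxt ?w ?\<rho>'"
        unfolding chip_addition_def by (subst while_unfold) (simp add: route_step_def)
      moreover have "routes \<rho> (unit v) (\<lambda>w. unit v w + u w) (\<lambda>_. 0)"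
        using routes_trans[OF routes_unit[OF True], of \<rho> "\<lambda>_. 0"] u(1) by (simp add: advance_unit)
      moreover have "advance \<rho> (\<lambda>w. unit v w + u w) = advance ?\<rho>' u"
        by (simp only: advance_add advance_unit)
      ultimately show ?thesis using u(2) by metis
    next
      case False
      then show ?thesis using Suc.prems(3) chip_addition_sink[of v \<rho>] by blast
    qed
  qed
  with route_terminates[OF assms] assms show ?thesis by blast
qed

section \<open>Repeated additions, their commutation, and the action of a chip configuration\<close>

lemma chip_addition_funpow_routes:
  assumes "\<rho> \<in> rotor_configs G" "v \<in> nonsinks G"
  shows "\<exists>u. routes \<rho> (\<lambda>w. n * unit v w) u (\<lambda>_. 0) \<and>
    (chip_addition G nxt v ^^ n) \<rho> = advance \<rho> u"
proof (induction n)
  case 0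
  show ?case by (rule exI[of _ "\<lambda>_. 0"]) (simp add: routes_0 advance_def)
next
  case (Suc n)
  then obtain u where u: "routes \<rho> (\<lambda>w. n * unit v w) u (\<lambda>_. 0)"
    "(chip_addition G nxt v ^^ n) \<rho> = advance \<rho> u" by blast
  obtain u' where u': "routes (advance \<rho> u) (unit v) u' (\<lambda>_. 0)"
    "chip_addition G nxt v (advance \<rho> u) = advance (advance \<rho> u) u'"
    using chip_addition_routes[OF advance_rotor_configs[OF assms(1) u(1)] assms(2)] by blast
  have "routes \<rho> (\<lambda>w. n * unit v w + unit v w) (\<lambda>w. u w + u' w) (\<lambda>_. 0)"
    by (rule routes_trans[OF u(1)]) (use u'(1) in simp)
  moreover have "(\<lambda>w. n * unit v w + unit v w) = (\<lambda>w. Suc n * unit v w)" by auto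
  ultimately show ?case using u(2) u'(2) by (auto simp: advance_add)
qed

text \<open>Chip addition is junk outside the rotor configurations, where it need not commute; replacing it
  by the identity there makes the fold well-behaved.\<close>

definition guarded_addition :: "('a \<Rightarrow> nat) \<Rightarrow> 'a \<Rightarrow> ('a \<Rightarrow> 'b) \<Rightarrow> 'a \<Rightarrow> 'b" where
  "guarded_addition \<sigma> v \<rho> =
     (if \<rho> \<in> rotor_configs G then (chip_addition G nxt v ^^ \<sigma> v) \<rho> else \<rho>)"

lemma guarded_addition_routes:
  assumes "\<rho> \<in> rotor_configs G" "v \<in> nonsinks G"
  shows "\<exists>u. routes \<rho> (\<lambda>w. \<sigma> v * unit v w) u (\<lambda>_. 0) \<and>
    guarded_addition \<sigma> v \<rho> = advance \<rho> u \<and> guarded_addition \<sigma> v \<rho> \<in> rotor_configs G"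
proof -
  obtain u where u: "routes \<rho> (\<lambda>w. \<sigma> v * unit v w) u (\<lambda>_. 0)"
    "(chip_addition G nxt v ^^ \<sigma> v) \<rho> = advance \<rho> u"
    using chip_addition_funpow_routes[OF assms, of "\<sigma> v"] by blast
  then have "guarded_addition \<sigma> v \<rho> = advance \<rho> u" using assms(1) by (simp add: guarded_addition_def)
  then show ?thesis using u(1) advance_rotor_configs[OF assms(1) u(1)] by auto
qed

text \<open>Both orders route the same chips completely, so the odometers agree by
  \<open>routes_unique\<close>, and these determine the final rotors from the initial ones.\<close>

lemma guarded_addition_commute:
  "comp_fun_commute_on (nonsinks G) (guarded_addition \<sigma>)"
proof
  fix v w assume vw: "v \<in> nonsinks G" "w \<in> nonsinks G"
  have *: "\<exists>u. routes \<rho> (\<lambda>x. \<sigma> v * unit v x + \<sigma> w * unit w x) u (\<lambda>_. 0) \<and>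
      guarded_addition \<sigma> w (guarded_addition \<sigma> v \<rho>) = advance \<rho> u"
    if \<rho>: "\<rho> \<in> rotor_configs G" and vw: "v \<in> nonsinks G" "w \<in> nonsinks G" for \<rho> v w
  proof -
    obtain u where u: "routes \<rho> (\<lambda>x. \<sigma> v * unit v x) u (\<lambda>_. 0)"
      "guarded_addition \<sigma> v \<rho> = advance \<rho> u" "guarded_addition \<sigma> v \<rho> \<in> rotor_configs G"
      using guarded_addition_routes[OF \<rho> vw(1), of \<sigma>] by blast
    obtain u' where u': "routes (guarded_addition \<sigma> v \<rho>) (\<lambda>x. \<sigma> w * unit w x) u' (\<lambda>_. 0)"
      "guarded_addition \<sigma> w (guarded_addition \<sigma> v \<rho>) = advance (guarded_addition \<sigma> v \<rho>) u'"
      using guarded_addition_routes[OF u(3) vw(2), of \<sigma>] by blast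
    have "routes \<rho> (\<lambda>x. \<sigma> v * unit v x + \<sigma> w * unit w x) (\<lambda>x. u x + u' x) (\<lambda>_. 0)"
      by (rule routes_trans[OF u(1)]) (use u'(1) u(2) in simp)
    then show ?thesis using u'(2) u(2) by (auto simp: advance_add)
  qed
  show "guarded_addition \<sigma> w \<circ> guarded_addition \<sigma> v = guarded_addition \<sigma> v \<circ> guarded_addition \<sigma> w"
  proof
    fix \<rho>
    show "(guarded_addition \<sigma> w \<circ> guarded_addition \<sigma> v) \<rho> =
      (guarded_addition \<sigma> v \<circ> guarded_addition \<sigma> w) \<rho>"
    proof (cases "\<rho> \<in> rotor_configs G")
      case True
      obtain u where u: "routes \<rho> (\<lambda>x. \<sigma> v * unit v x + \<sigma> w * unit w x) u (\<lambda>_. 0)"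
        "guarded_addition \<sigma> w (guarded_addition \<sigma> v \<rho>) = advance \<rho> u"
        using *[OF True vw] by blast
      obtain u' where u': "routes \<rho> (\<lambda>x. \<sigma> w * unit w x + \<sigma> v * unit v x) u' (\<lambda>_. 0)"
        "guarded_addition \<sigma> v (guarded_addition \<sigma> w \<rho>) = advance \<rho> u'"
        using *[OF True vw(2,1)] by blast
      have "u = u'" using routes_unique[OF u(1)] u'(1) by (simp add: add.commute)
      then show ?thesis using u(2) u'(2) by simp
    next
      case False
      then show ?thesis by (simp add: guarded_addition_def)
    qed
  qed
qed

text \<open>The odometers of the additions at the single vertices add up to one odometer for all the
  chips. The \<open>if\<close> blanks values of \<open>\<sigma>\<close> that the fold never
  reads.\<close>

lemma chip_action_routes:
  assumes "\<rho> \<in> rotor_configs G"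
  shows "\<exists>u. routes \<rho> (\<lambda>w. if w \<in> nonsinks G then \<sigma> w else 0) u (\<lambda>_. 0) \<and>
    chip_action G nxt \<sigma> \<rho> = advance \<rho> u"
proof -
  interpret comp_fun_commute_on "nonsinks G" "guarded_addition \<sigma>"
    by (rule guarded_addition_commute)
  have "\<exists>u. routes \<rho> (\<lambda>w. if w \<in> A then \<sigma> w else 0) u (\<lambda>_. 0) \<and>
      Finite_Set.fold (guarded_addition \<sigma>) \<rho> A = advance \<rho> u"
    if "finite A" "A \<subseteq> nonsinks G" for A
    using that
  proof induction
    case empty
    show ?case by (rule exI[of _ "\<lambda>_. 0"]) (simp add: routes_0 advance_def)
  next
    case (insert v A)
    then obtain u where u: "routes \<rho> (\<lambda>w. if w \<in> A then \<sigma> w else 0) u (\<lambda>_. 0)"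
      "Finite_Set.fold (guarded_addition \<sigma>) \<rho> A = advance \<rho> u" by auto
    have v: "v \<in> nonsinks G" using insert.prems by simp
    obtain u' where u': "routes (advance \<rho> u) (\<lambda>w. \<sigma> v * unit v w) u' (\<lambda>_. 0)"
      "guarded_addition \<sigma> v (advance \<rho> u) = advance (advance \<rho> u) u'"
      using guarded_addition_routes[OF advance_rotor_configs[OF assms u(1)] v, of \<sigma>] by blast
    have "routes \<rho> (\<lambda>w. (if w \<in> A then \<sigma> w else 0) + \<sigma> v * unit v w) (\<lambda>w. u w + u' w) (\<lambda>_. 0)"
      by (rule routes_trans[OF u(1)]) (use u'(1) in simp)
    moreover have "(\<lambda>w. (if w \<in> A then \<sigma> w else 0) + \<sigma> v * unit v w) =
        (\<lambda>w. if w \<in> insert v A then \<sigma> w else 0)"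
      using insert.hyps by auto
    moreover have "Finite_Set.fold (guarded_addition \<sigma>) \<rho> (insert v A) = advance \<rho> (\<lambda>w. u w + u' w)"
      using fold_insert[OF insert.prems insert.hyps] u(2) u'(2) by (simp add: advance_add)
    ultimately show ?case by metis
  qed
  \<comment> \<open>The guarded maps preserve \<open>rotor_configs G\<close> and agree there with
    the unguarded ones, so the two folds coincide.\<close>
  moreover have "chip_action G nxt \<sigma> \<rho> = Finite_Set.fold (guarded_addition \<sigma>) \<rho> (nonsinks G)"
    unfolding chip_action_def
  proof (rule fold_closed_eq[where B = "rotor_configs G"])
    fix v \<rho>' assume "v \<in> nonsinks G" "\<rho>' \<in> rotor_configs G"
    then show "guarded_addition \<sigma> v \<rho>' \<in> rotor_configs G" using guarded_addition_routes[of \<rho>' v \<sigma>] by auto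
  qed (simp_all add: guarded_addition_def assms)
  ultimately show ?thesis using finite_nonsinks by simp
qed

section \<open>Comparison of two routings with equal final rotors\<close>

lemma sum_head_out_arcs: "(\<Sum>e\<in>out_arcs G v. of_bool (head G e = w)) = edge_count G v w"
proof -
  have eq: "out_arcs G v \<inter> {e. head G e = w} = {e \<in> arcs G. tail G e = v \<and> head G e = w}" by auto
  have "(\<Sum>e\<in>out_arcs G v. of_bool (head G e = w)) = card (out_arcs G v \<inter> {e. head G e = w})"
    by (subst sum_of_bool_eq) auto
  then show ?thesis unfolding eq edge_count_def .
qed

text \<open>Equal final rotors force the odometers to differ at each vertex by a multiple \<open>c v\<close> of its degree,
  so that each arc out of \<open>v\<close> is crossed \<open>c v\<close> more times in one routing than in the other.\<close>

lemma chip_action_eqD: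
  assumes \<rho>: "\<rho> \<in> rotor_configs G" and eq: "chip_action G nxt \<sigma>\<^sub>1 \<rho> = chip_action G nxt \<sigma>\<^sub>2 \<rho>"
  shows "\<exists>c. \<forall>w\<in>nonsinks G. int (\<sigma>\<^sub>1 w) = int (\<sigma>\<^sub>2 w) + laplacian G c w"
proof -
  obtain u\<^sub>1 where u1: "routes \<rho> (\<lambda>w. if w \<in> nonsinks G then \<sigma>\<^sub>1 w else 0) u\<^sub>1 (\<lambda>_. 0)"
    "chip_action G nxt \<sigma>\<^sub>1 \<rho> = advance \<rho> u\<^sub>1" using chip_action_routes[OF \<rho>] by blast
  obtain u\<^sub>2 where u2: "routes \<rho> (\<lambda>w. if w \<in> nonsinks G then \<sigma>\<^sub>2 w else 0) u\<^sub>2 (\<lambda>_. 0)"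
    "chip_action G nxt \<sigma>\<^sub>2 \<rho> = advance \<rho> u\<^sub>2" using chip_action_routes[OF \<rho>] by blast
  have "advance \<rho> u\<^sub>1 v = advance \<rho> u\<^sub>2 v" for v using eq u1(2) u2(2) by simp
  then have "\<exists>c::int. int (u\<^sub>1 v) = int (u\<^sub>2 v) + c * int (out_degree G v) \<and>
      (\<forall>g. int (\<Sum>i<u\<^sub>1 v. g ((nxt ^^ Suc i) (\<rho> v))) =
        int (\<Sum>i<u\<^sub>2 v. g ((nxt ^^ Suc i) (\<rho> v))) + c * int (sum g (out_arcs G v)))"
    if "v \<in> nonsinks G" for v
    unfolding out_degree_def
    using cyclic_on_funpow_eqD[OF _ rotor_in_out_arcs[OF \<rho> that]] rotor_ordering that
    by (simp only: rotor_ordering_def advance_def)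
  then obtain c :: "'a \<Rightarrow> int" where
    c: "\<And>v. v \<in> nonsinks G \<Longrightarrow> int (u\<^sub>1 v) = int (u\<^sub>2 v) + c v * int (out_degree G v)" and
    flow: "\<And>v g. v \<in> nonsinks G \<Longrightarrow> int (\<Sum>i<u\<^sub>1 v. g ((nxt ^^ Suc i) (\<rho> v))) =
        int (\<Sum>i<u\<^sub>2 v. g ((nxt ^^ Suc i) (\<rho> v))) + c v * int (sum g (out_arcs G v))"
    by metis
  \<comment> \<open>Taking for \<open>g\<close> the indicator of head \<open>w\<close> turns the sum
    over a full turn at \<open>v\<close> into the number of arcs from \<open>v\<close> to
    \<open>w\<close>.\<close>
  have inflow: "int (inflow \<rho> u\<^sub>1 w) =
      int (inflow \<rho> u\<^sub>2 w) + (\<Sum>v\<in>nonsinks G. c v * int (edge_count G v w))" for w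
    unfolding inflow_def of_nat_sum[of _ "nonsinks G"] sum.distrib[symmetric]
    by (intro sum.cong refl)
      (use flow[where g = "\<lambda>e. of_bool (head G e = w)"] in \<open>simp only: sum_head_out_arcs\<close>)
  have "int (\<sigma>\<^sub>1 w) = int (\<sigma>\<^sub>2 w) + laplacian G c w" if w: "w \<in> nonsinks G" for w
  proof -
    \<comment> \<open>Both routings leave no chip on a non-sink, so initial chips plus arrivals
      equal departures; subtracting the two balances yields the Laplacian.\<close>
    have "\<sigma>\<^sub>1 w + inflow \<rho> u\<^sub>1 w = u\<^sub>1 w" "\<sigma>\<^sub>2 w + inflow \<rho> u\<^sub>2 w = u\<^sub>2 w"
      using u1(1) u2(1) w by (simp_all add: routes_def)
    then have "int (\<sigma>\<^sub>1 w) + int (inflow \<rho> u\<^sub>1 w) = int (u\<^sub>1 w)"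
      "int (\<sigma>\<^sub>2 w) + int (inflow \<rho> u\<^sub>2 w) = int (u\<^sub>2 w)" by linarith+
    then show ?thesis using c[OF w] inflow[of w] by (simp add: laplacian_def algebra_simps)
  qed
  then show ?thesis by blast
qed

end

theorem lemma3p17:
  fixes G :: "('v, 'e) pre_digraph"
    and s :: 'v
    and nxt :: "'e \<Rightarrow> 'e"
    and \<sigma>\<^sub>1 \<sigma>\<^sub>2 :: "'v \<Rightarrow> nat"
  assumes "fin_digraph G"
    and "global_sink G s"
    and "rotor_ordering G nxt"
    and "recurrent G \<sigma>\<^sub>1"
    and "recurrent G \<sigma>\<^sub>2"
    and "\<exists>\<rho> \<in> rotor_configs G. acyclic_rotor G \<rho> \<and>
           chip_action G nxt \<sigma>\<^sub>1 \<rho> = chip_action G nxt \<sigma>\<^sub>2 \<rho>"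
  shows "\<sigma>\<^sub>1 = \<sigma>\<^sub>2"
proof -
  interpret rotor_router G s nxt
    using assms by (intro rotor_router.intro rotor_router_axioms.intro)
  obtain c where "\<forall>w\<in>nonsinks G. int (\<sigma>\<^sub>1 w) = int (\<sigma>\<^sub>2 w) + laplacian G c w"
    using assms(6) chip_action_eqD by blast
  then show ?thesis
    using recurrent_laplacian_unique[OF assms(4,5)] by blast
qed

end
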